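(* Let $H$ be a graph with at least one edge. There is an optimal online algorithm with advice for the Delayed $H$-Edge-Deletion Problem that reads at most $\mathrm{opt} \cdot \log \|H\| + O(\log \mathrm{opt})$ bits of advice.
   Context: Graphs are finite, simple and undirected. $\|G\|$ is the number of edges of $G$; $\log$ is base 2. A graph $G$ is $H$-free if $H$ is not isomorphic to an induced subgraph of $G$. Delayed $H$-Edge-Deletion Problem: $H$ is a fixed graph with at least one edge. An instance is a graph $G$ with an ordering $v_1,\dots,v_n$ of its vertices. In step $i$, vertex $v_i$ and its adjacencies to $v_1,\dots,v_{i-1}$ are revealed, and the algorithm (not knowing the future vertices or $n$) must output a set $S_i\subseteq E(G[\{v_1,\dots,v_i\}])$ such that the graph $G[\{v_1,\dots,v_i\}]-S_i$ obtained by deleting the edges in $S_i$ is $H$-free; moreover $S_1\subseteq\dots\subseteq S_n$. The goal is to minimize $|S_n|$. For an instance, $\mathrm{opt}$ is the minimum size of a set $S\subseteq E(G)$ with $G-S$ $H$-free. An online algorithm with advice is deterministic, and additionally may sequentially read bits from an infinite binary tape. It is optimal if for every instance $I$ there is a tape content $\phi_I$ (chosen by an oracle knowing $I$) with which it outputs a solution of size $\mathrm{opt}(I)$ on $I$. It reads at most $b(\mathrm{opt})$ bits of advice if the $\phi_I$ can be chosen such that, additionally, at most $b(\mathrm{opt}(I))$ tape bits are read on every instance $I$. The $O$-notation refers to $\mathrm{opt}\to\infty$ with constants depending only on $H$. *)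

theory Defs
  imports Complex_Main "HOL-Library.Landau_Symbols"
begin

section \<open>Finite simple undirected graphs\<close>

record 'v sgraph =
  verts :: "'v set"
  edges :: "'v set set"

definition simple_graph :: "'v sgraph \<Rightarrow> bool" where
  "simple_graph G \<longleftrightarrow> finite (verts G) \<and> (\<forall>e\<in>edges G. e \<subseteq> verts G \<and> card e = 2)"

definition induced :: "'v sgraph \<Rightarrow> 'v set \<Rightarrow> 'v sgraph" where
  "induced G W = \<lparr>verts = W, edges = {e \<in> edges G. e \<subseteq> W}\<rparr>"

definition delete_edges :: "'v sgraph \<Rightarrow> 'v set set \<Rightarrow> 'v sgraph" where
  "delete_edges G S = \<lparr>verts = verts G, edges = edges G - S\<rparr>"

definition isomorphic :: "'u sgraph \<Rightarrow> 'v sgraph \<Rightarrow> bool" where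
  "isomorphic G K \<longleftrightarrow>
     (\<exists>f. bij_betw f (verts G) (verts K) \<and>
          (\<forall>u\<in>verts G. \<forall>v\<in>verts G. {u, v} \<in> edges G \<longleftrightarrow> {f u, f v} \<in> edges K))"

definition free_of :: "'h sgraph \<Rightarrow> 'v sgraph \<Rightarrow> bool" where
  "free_of H G \<longleftrightarrow> \<not> (\<exists>W \<subseteq> verts G. isomorphic H (induced G W))"


section \<open>The delayed edge-deletion problem\<close>

definition online_instance :: "'v sgraph \<Rightarrow> 'v list \<Rightarrow> bool" where
  "online_instance G vs \<longleftrightarrow> simple_graph G \<and> distinct vs \<and> set vs = verts G"

definition revealed :: "'v sgraph \<Rightarrow> 'v list \<Rightarrow> nat \<Rightarrow> 'v sgraph" where
  "revealed G vs i = induced G (set (take i vs))"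

text \<open>The list \<open>Ss\<close> is 0-based: the set chosen in step \<open>i\<close> is \<open>Ss ! (i - 1)\<close>.\<close>

definition online_solution :: "'h sgraph \<Rightarrow> 'v sgraph \<Rightarrow> 'v list \<Rightarrow> 'v set set list \<Rightarrow> bool" where
  "online_solution H G vs Ss \<longleftrightarrow>
     length Ss = length vs \<and>
     (\<forall>i\<in>{1..length vs}.
        Ss ! (i - 1) \<subseteq> edges (revealed G vs i) \<and>
        free_of H (delete_edges (revealed G vs i) (Ss ! (i - 1)))) \<and>
     sorted_wrt (\<subseteq>) Ss"

text \<open>The leading \<open>{}\<close> only matters for the instance without vertices, whose cost is 0.\<close>

definition cost :: "'v set set list \<Rightarrow> nat" where
  "cost Ss = card (last ({} # Ss))"

text \<open>If \<open>H\<close> has an edge, then \<open>S = edges G\<close> shows that the minimum exists.\<close>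

definition opt :: "'h sgraph \<Rightarrow> 'v sgraph \<Rightarrow> nat" where
  "opt H G = (LEAST k. \<exists>S \<subseteq> edges G. free_of H (delete_edges G S) \<and> card S = k)"


section \<open>Online algorithms with advice\<close>

text \<open>
  A deterministic algorithm is given by its next action as a function of everything it has
  seen: the vertices revealed so far in their order of arrival, the graph induced on them, and
  the advice bits read so far (over all steps). It either asks for the next bit of the
  tape or outputs the edge set of the current step. Its internal state and its previous outputs
  are functions of this information, so they are no separate arguments. On some tapes it may
  keep reading forever, in which case it has no complete run.
\<close>

datatype 'v action = Read_Bit | Output "'v set set"

type_synonym 'v advice_algorithm = "'v list \<Rightarrow> 'v sgraph \<Rightarrow> bool list \<Rightarrow> 'v action"

type_synonym tape = "nat \<Rightarrow> bool"

definition tape_prefix :: "tape \<Rightarrow> nat \<Rightarrow> bool list" where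
  "tape_prefix \<phi> m = map \<phi> [0..<m]"

text \<open>
  \<open>step_run A us K \<phi> m S m'\<close>: in the step in which \<open>us\<close> and \<open>K\<close> are the revealed vertices and
  graph, the algorithm, having read \<open>m\<close> bits before, outputs \<open>S\<close> when it has read \<open>m'\<close> bits in total.
\<close>

inductive step_run ::
  "'v advice_algorithm \<Rightarrow> 'v list \<Rightarrow> 'v sgraph \<Rightarrow> tape \<Rightarrow> nat \<Rightarrow> 'v set set \<Rightarrow> nat \<Rightarrow> bool"
  for A us K \<phi> where
  output_set: "A us K (tape_prefix \<phi> m) = Output S \<Longrightarrow> step_run A us K \<phi> m S m"
| read_bit: "A us K (tape_prefix \<phi> m) = Read_Bit \<Longrightarrow> step_run A us K \<phi> (Suc m) S m' \<Longrightarrow>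
    step_run A us K \<phi> m S m'"

text \<open>
  \<open>partial_run A G vs \<phi> Ss m\<close>: the outputs of the first \<open>length Ss\<close> steps are \<open>Ss\<close>, and \<open>m\<close> bits are
  read during these steps.
\<close>

inductive partial_run ::
  "'v advice_algorithm \<Rightarrow> 'v sgraph \<Rightarrow> 'v list \<Rightarrow> tape \<Rightarrow> 'v set set list \<Rightarrow> nat \<Rightarrow> bool"
  for A G vs \<phi> where
  run_start: "partial_run A G vs \<phi> [] 0"
| run_step: "partial_run A G vs \<phi> Ss m \<Longrightarrow> i = Suc (length Ss) \<Longrightarrow> i \<le> length vs \<Longrightarrow>
    step_run A (take i vs) (revealed G vs i) \<phi> m S m' \<Longrightarrow>
    partial_run A G vs \<phi> (Ss @ [S]) m'"

definition complete_run ::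
  "'v advice_algorithm \<Rightarrow> 'v sgraph \<Rightarrow> 'v list \<Rightarrow> tape \<Rightarrow> 'v set set list \<Rightarrow> nat \<Rightarrow> bool" where
  "complete_run A G vs \<phi> Ss m \<longleftrightarrow> partial_run A G vs \<phi> Ss m \<and> length Ss = length vs"

definition optimal_with_advice ::
  "'h sgraph \<Rightarrow> 'v advice_algorithm \<Rightarrow> (nat \<Rightarrow> real) \<Rightarrow> bool" where
  "optimal_with_advice H A b \<longleftrightarrow>
     (\<forall>G vs. online_instance G vs \<longrightarrow>
        (\<exists>\<phi> Ss m. complete_run A G vs \<phi> Ss m \<and>
           online_solution H G vs Ss \<and> cost Ss = opt H G \<and>
           real m \<le> b (opt H G)))"

end

theory Submission
  imports Defs
begin

text \<open>
  Fix an optimal solution \<open>T\<close>. As long as the current graph minus the edges deleted so far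
  contains an induced copy of \<open>H\<close>, and all these edges lie in \<open>T\<close>, the copy must contain a further
  edge of \<open>T\<close>, because the final graph minus \<open>T\<close> is \<open>H\<close>-free. A number below \<open>\<parallel>H\<parallel>\<close> names such an
  edge, and every number spent enlarges the set of deleted edges by an element of \<open>T\<close>. Hence \<open>opt\<close>
  many numbers suffice. The oracle writes \<open>opt\<close> in a prefix-free code of logarithmic length,
  followed by the index of the sequence of numbers among all \<open>\<parallel>H\<parallel>\<^bsup>opt\<^esup>\<close> many.
\<close>

section \<open>Induced subgraphs and copies\<close>

lemma simple_graph_induced: "simple_graph G \<Longrightarrow> W \<subseteq> verts G \<Longrightarrow> simple_graph (induced G W)"
  by (auto simp: simple_graph_def induced_def intro: finite_subset)

lemma simple_graph_delete_edges: "simple_graph G \<Longrightarrow> simple_graph (delete_edges G S)"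
  by (auto simp: simple_graph_def delete_edges_def)

lemma finite_edges: "simple_graph G \<Longrightarrow> finite (edges G)"
  by (rule finite_subset[of _ "Pow (verts G)"]) (auto simp: simple_graph_def)

text \<open>Pulling both ends of an edge of \<open>K\<close> back along the isomorphism gives an
  edge of \<open>H\<close>. This serves to bound the number of edges of a copy, hence the range of
  the numbers that name them.\<close>

lemma isomorphic_edges_subset:
  assumes "isomorphic H K" and "simple_graph K"
  obtains f where "edges K \<subseteq> image f ` edges H"
proof -
  obtain f where f: "bij_betw f (verts H) (verts K)"
    and iso: "\<And>u v. u \<in> verts H \<Longrightarrow> v \<in> verts H \<Longrightarrow> {u, v} \<in> edges H \<longleftrightarrow> {f u, f v} \<in> edges K"
    using assms(1) unfolding isomorphic_def by blast
  have "edges K \<subseteq> image f ` edges H"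
  proof
    fix e assume e: "e \<in> edges K"
    then have "e \<subseteq> verts K" "card e = 2"
      using assms(2) by (auto simp: simple_graph_def)
    then obtain x y where xy: "e = {x, y}" "x \<in> verts K" "y \<in> verts K"
      by (auto simp: card_2_iff)
    then obtain u v where uv: "u \<in> verts H" "v \<in> verts H" "x = f u" "y = f v"
      using f by (metis bij_betw_imp_surj_on imageE)
    then have "{u, v} \<in> edges H" using iso e xy by auto
    moreover have "e = f ` {u, v}" using xy uv by auto
    ultimately show "e \<in> image f ` edges H" by blast
  qed
  then show ?thesis by (rule that)
qed

lemma isomorphic_card_edges_le:
  assumes "isomorphic H K" and "simple_graph K" and "finite (edges H)"
  shows "finite (edges K)" and "card (edges K) \<le> card (edges H)"
proof -
  obtain f where f: "edges K \<subseteq> image f ` edges H"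
    using isomorphic_edges_subset[OF assms(1,2)] .
  then show "finite (edges K)" using assms(3) finite_surj by blast
  show "card (edges K) \<le> card (edges H)" using f assms(3) surj_card_le by blast
qed

lemma induced_induced: "V \<subseteq> W \<Longrightarrow> induced (induced G W) V = induced G V"
  by (auto simp: induced_def)

lemma delete_edges_induced: "delete_edges (induced G W) S = induced (delete_edges G S) W"
  by (auto simp: induced_def delete_edges_def)

lemma free_of_induced:
  assumes "free_of H G" and "W \<subseteq> verts G"
  shows "free_of H (induced G W)"
  unfolding free_of_def
proof
  assume "\<exists>V\<subseteq>verts (induced G W). isomorphic H (induced (induced G W) V)"
  then obtain V where "V \<subseteq> W" "isomorphic H (induced (induced G W) V)"
    by (auto simp: induced_def)
  then show False using assms by (auto simp: induced_induced free_of_def)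
qed

text \<open>An edge of \<open>H\<close> would have to be mapped to an edge of \<open>G\<close>.
  Hence deleting all edges is always feasible, and \<open>opt\<close> is attained.\<close>

lemma free_of_edgeless:
  assumes "simple_graph H" and "edges H \<noteq> {}" and "edges G = {}"
  shows "free_of H G"
  unfolding free_of_def
proof
  assume "\<exists>W\<subseteq>verts G. isomorphic H (induced G W)"
  then obtain W f where
    f: "\<forall>u\<in>verts H. \<forall>v\<in>verts H. {u, v} \<in> edges H \<longleftrightarrow> {f u, f v} \<in> edges (induced G W)"
    unfolding isomorphic_def by blast
  obtain u v where "{u, v} \<in> edges H" "u \<in> verts H" "v \<in> verts H"
    using assms(1,2) unfolding simple_graph_def
    by (metis all_not_in_conv card_2_iff insert_subset)
  with f have "{f u, f v} \<in> edges (induced G W)" by blast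
  then show False using assms(3) by (simp add: induced_def)
qed

lemma opt_attained:
  assumes "simple_graph H" and "edges H \<noteq> {}"
  obtains T where "T \<subseteq> edges G" and "free_of H (delete_edges G T)" and "card T = opt H G"
proof -
  have "\<exists>k. \<exists>S\<subseteq>edges G. free_of H (delete_edges G S) \<and> card S = k"
    using free_of_edgeless[OF assms, of "delete_edges G (edges G)"]
    by (auto simp: delete_edges_def)
  from LeastI_ex[OF this] show ?thesis
    using that unfolding opt_def by blast
qed

lemma opt_le: "S \<subseteq> edges G \<Longrightarrow> free_of H (delete_edges G S) \<Longrightarrow> opt H G \<le> card S"
  unfolding opt_def by (rule Least_le) blast


section \<open>Destroying copies along a list of numbers\<close>

text \<open>The chosen copy depends on \<open>H\<close> and the current graph only, so oracle and
  algorithm agree on it without any advice.\<close>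

definition copy_edges :: "'h sgraph \<Rightarrow> 'v sgraph \<Rightarrow> 'v set set" where
  "copy_edges H K = edges (induced K (SOME W. W \<subseteq> verts K \<and> isomorphic H (induced K W)))"

text \<open>The length condition rules out repetitions in the enumeration, so indices below
  \<open>card (edges H)\<close> reach every edge of a copy.\<close>

definition copy_edge :: "'h sgraph \<Rightarrow> 'v sgraph \<Rightarrow> nat \<Rightarrow> 'v set" where
  "copy_edge H K d =
     (SOME es. set es = copy_edges H K \<and> length es = card (copy_edges H K)) ! d"

text \<open>A number is consumed only while a copy is left, and the unread rest is handed on to
  later steps. If the list runs out first, the current set is returned as it is.\<close>

primrec resolve ::
  "'h sgraph \<Rightarrow> 'v sgraph \<Rightarrow> 'v set set \<Rightarrow> nat list \<Rightarrow> 'v set set \<times> nat list" where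
  "resolve H K S [] = (S, [])"
| "resolve H K S (d # ds) =
     (if free_of H (delete_edges K S) then (S, d # ds)
      else resolve H K (insert (copy_edge H (delete_edges K S) d) S) ds)"

primrec resolve_steps ::
  "'h sgraph \<Rightarrow> 'v sgraph \<Rightarrow> 'v list \<Rightarrow> nat list \<Rightarrow> nat \<Rightarrow> 'v set set \<times> nat list" where
  "resolve_steps H G vs ds 0 = ({}, ds)"
| "resolve_steps H G vs ds (Suc i) =
     (case resolve_steps H G vs ds i of (S, ds') \<Rightarrow> resolve H (revealed G vs (Suc i)) S ds')"

lemma resolve_free: "free_of H (delete_edges K S) \<Longrightarrow> resolve H K S ds = (S, ds)"
  by (cases ds) auto

text \<open>If \<open>T\<close> missed the chosen copy, the copy would survive the deletion of
  \<open>T\<close>. So some edge of the copy lies in \<open>T\<close>, and the size of the copy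
  bounds its index.\<close>

lemma copy_edge_surj:
  assumes "simple_graph K" and "finite (edges H)" and "\<not> free_of H K" and "free_of H (delete_edges K T)"
  obtains d where "d < card (edges H)" and "copy_edge H K d \<in> T \<inter> edges K"
proof -
  define W where "W = (SOME W. W \<subseteq> verts K \<and> isomorphic H (induced K W))"
  have W: "W \<subseteq> verts K" "isomorphic H (induced K W)"
    unfolding W_def using assms(3) by (metis (mono_tags, lifting) someI_ex free_of_def)+
  have ce: "copy_edges H K = edges (induced K W)"
    by (simp add: copy_edges_def W_def)
  have card: "card (copy_edges H K) \<le> card (edges H)" "finite (copy_edges H K)"
    using isomorphic_card_edges_le[OF W(2) simple_graph_induced[OF assms(1) W(1)] assms(2)]
    by (auto simp: ce)
  define es where "es = (SOME es. set es = copy_edges H K \<and> length es = card (copy_edges H K))"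
  have "\<exists>es. set es = copy_edges H K \<and> length es = card (copy_edges H K)"
    using finite_distinct_list[OF card(2)] distinct_card by metis
  then have es: "set es = copy_edges H K" "length es = card (copy_edges H K)"
    unfolding es_def by (metis (mono_tags, lifting) someI_ex)+
  have "\<exists>e \<in> copy_edges H K. e \<in> T"
  proof (rule ccontr)
    assume "\<not> ?thesis"
    then have "induced (delete_edges K T) W = induced K W"
      by (auto simp: ce induced_def delete_edges_def)
    then show False
      using W assms(4) by (metis free_of_def delete_edges_def select_convs(1))
  qed
  then obtain d where d: "d < length es" "es ! d \<in> T"
    using es(1) by (metis in_set_conv_nth)
  have "es ! d \<in> edges K"
    using d(1) es(1) ce nth_mem by (fastforce simp: induced_def)
  moreover have "copy_edge H K d = es ! d"
    by (simp add: copy_edge_def es_def)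
  ultimately show ?thesis using d es(2) card(1) that[of d] by simp
qed

text \<open>Each number moves one edge of \<open>T\<close> into \<open>S\<close>, so
  \<open>card (T - S)\<close> decreases. Since the procedure stops once no copy is left, it never
  looks at \<open>rest\<close>; this allows the blocks of successive steps to be
  concatenated.\<close>

lemma resolve_into:
  assumes "simple_graph K" and "finite (edges H)" and "finite T"
    and "free_of H (delete_edges K T)" and "S \<subseteq> T \<inter> edges K"
  shows "\<exists>ds S'. set ds \<subseteq> {..<card (edges H)} \<and> S \<subseteq> S' \<and> S' \<subseteq> T \<inter> edges K \<and>
    free_of H (delete_edges K S') \<and> card S' = card S + length ds \<and>
    (\<forall>rest. resolve H K S (ds @ rest) = (S', rest))"
  using assms(5)
proof (induction "card (T - S)" arbitrary: S rule: less_induct)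
  case less
  show ?case
  proof (cases "free_of H (delete_edges K S)")
    case True
    then show ?thesis using less.prems by (intro exI[of _ "[]"] exI[of _ S]) (auto simp: resolve_free)
  next
    case False
    \<comment> \<open>As \<open>S \<subseteq> T\<close>, the set \<open>T\<close> also solves the
      graph with \<open>S\<close> deleted. The edge named next is still present there, hence is new
      to \<open>S\<close>.\<close>
    have "delete_edges (delete_edges K S) T = delete_edges K T"
      using less.prems by (auto simp: delete_edges_def)
    then obtain d where d: "d < card (edges H)"
      and e: "copy_edge H (delete_edges K S) d \<in> T \<inter> edges (delete_edges K S)"
      using copy_edge_surj[OF simple_graph_delete_edges[OF assms(1)] assms(2) False] assms(4)
      by metis
    define e where "e = copy_edge H (delete_edges K S) d"
    have e': "e \<in> T" "e \<in> edges K" "e \<notin> S"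
      using e by (auto simp: e_def delete_edges_def)
    have "card (T - insert e S) < card (T - S)"
      using e' assms(3) by (intro psubset_card_mono) auto
    then obtain ds S' where IH: "set ds \<subseteq> {..<card (edges H)}" "insert e S \<subseteq> S'"
      "S' \<subseteq> T \<inter> edges K" "free_of H (delete_edges K S')"
      "card S' = card (insert e S) + length ds"
      "\<forall>rest. resolve H K (insert e S) (ds @ rest) = (S', rest)"
      using less.hyps[of "insert e S"] e' less.prems by auto
    have "finite S" using less.prems assms(3) finite_subset by auto
    then show ?thesis
      using IH d e' False by (intro exI[of _ "d # ds"] exI[of _ S']) (auto simp: e_def)
  qed
qed

text \<open>Every step appends its own block of numbers. The quantifier over \<open>rest\<close>
  ensures that appending later blocks leaves the earlier outputs unchanged.\<close>

lemma resolve_steps_into: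
  assumes "online_instance G vs" and "finite (edges H)" and "T \<subseteq> edges G"
    and "free_of H (delete_edges G T)" and "i \<le> length vs"
  shows "\<exists>ds S. set ds \<subseteq> {..<card (edges H)} \<and> S \<subseteq> T \<and> card S = length ds \<and>
    (\<forall>rest. resolve_steps H G vs (ds @ rest) i = (S, rest)) \<and>
    (\<forall>j \<in> {1..i}. \<forall>rest. let Sj = fst (resolve_steps H G vs (ds @ rest) j) in
       Sj \<subseteq> edges (revealed G vs j) \<and> free_of H (delete_edges (revealed G vs j) Sj) \<and>
       fst (resolve_steps H G vs (ds @ rest) (j - 1)) \<subseteq> Sj)"
  using assms(5)
proof (induction i)
  case 0
  then show ?case by (intro exI[of _ "[]"] exI[of _ "{}"]) auto
next
  case (Suc i)
  let ?K = "revealed G vs (Suc i)"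
  let ?good = "\<lambda>ds j. let Sj = fst (resolve_steps H G vs ds j) in
       Sj \<subseteq> edges (revealed G vs j) \<and> free_of H (delete_edges (revealed G vs j) Sj) \<and>
       fst (resolve_steps H G vs ds (j - 1)) \<subseteq> Sj"
  obtain ds S where IH: "set ds \<subseteq> {..<card (edges H)}" "S \<subseteq> T" "card S = length ds"
    "\<And>rest. resolve_steps H G vs (ds @ rest) i = (S, rest)"
    "\<And>j rest. j \<in> {1..i} \<Longrightarrow> ?good (ds @ rest) j"
    using Suc.IH Suc.prems by (auto simp del: atLeastAtMost_iff)
  have G: "simple_graph G" "set vs = verts G"
    using assms(1) by (auto simp: online_instance_def)
  have sub: "set (take (Suc i) vs) \<subseteq> verts G"
    using G(2) set_take_subset by metis
  \<comment> \<open>The induction hypothesis covers steps from 1 on; before the first step the set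
    is empty.\<close>
  have SK: "S \<subseteq> edges ?K"
  proof (cases "i = 0")
    case True
    then show ?thesis using IH(4)[of "[]"] by simp
  next
    case False
    then have "S \<subseteq> edges (revealed G vs i)"
      using IH(5)[of i "[]"] IH(4)[of "[]"] by (auto simp: Let_def)
    also have "\<dots> \<subseteq> edges ?K"
      using set_take_subset_set_take[of i "Suc i" vs] by (auto simp: revealed_def induced_def)
    finally show ?thesis .
  qed
  \<comment> \<open>Deleting edges commutes with taking induced subgraphs, so \<open>T\<close>
    solves every revealed graph as well.\<close>
  have K: "simple_graph ?K" "free_of H (delete_edges ?K T)"
    using G(1) sub free_of_induced[OF assms(4), of "set (take (Suc i) vs)"]
    by (auto simp: revealed_def delete_edges_induced simple_graph_induced delete_edges_def[of G])
  have "finite T" using assms(3) finite_edges[OF G(1)] finite_subset by blast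
  then obtain ds' S' where S': "set ds' \<subseteq> {..<card (edges H)}" "S \<subseteq> S'" "S' \<subseteq> T \<inter> edges ?K"
    "free_of H (delete_edges ?K S')" "card S' = card S + length ds'"
    "\<And>rest. resolve H ?K S (ds' @ rest) = (S', rest)"
    using resolve_into[OF K(1) assms(2) _ K(2), of S] IH(2) SK by auto
  have run: "resolve_steps H G vs ((ds @ ds') @ rest) (Suc i) = (S', rest)" for rest
    using IH(4) S'(6) by simp
  have good: "?good ((ds @ ds') @ rest) j" if "j \<in> {1..Suc i}" for j rest
  proof (cases "j = Suc i")
    case True
    have "fst (resolve_steps H G vs ((ds @ ds') @ rest) i) = S" using IH(4) by simp
    then show ?thesis unfolding Let_def True run diff_Suc_1 using S' by simp
  next
    case False
    then show ?thesis using IH(5)[of j "ds' @ rest"] that by simp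
  qed
  show ?case
    using IH(1,3) S'(1,3,5) run good
    by (intro exI[of _ "ds @ ds'"] exI[of _ S']) auto
qed

text \<open>The first \<open>i\<close> steps can be replayed from what is visible in step
  \<open>i\<close>, which makes the procedure online.\<close>

lemma resolve_steps_revealed:
  assumes "j \<le> i"
  shows "resolve_steps H (revealed G vs i) (take i vs) ds j = resolve_steps H G vs ds j"
  using assms
proof (induction j)
  case (Suc j)
  have "revealed (revealed G vs i) (take i vs) (Suc j) = revealed G vs (Suc j)"
    using Suc.prems set_take_subset_set_take[of "Suc j" i vs]
    by (simp add: revealed_def induced_induced min_def)
  with Suc show ?case by simp
qed simp


section \<open>A prefix-free code for lists of bounded numbers\<close>

text \<open>Binary digits, least significant first, each announced by \<open>True\<close>; a final
  \<open>False\<close> makes the code self-delimiting.\<close>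

fun nat_code :: "nat \<Rightarrow> bool list" where
  "nat_code n = (if n = 0 then [False] else True # odd n # nat_code (n div 2))"

declare nat_code.simps[simp del]

lemma nat_code_prefix_free:
  "nat_code a @ x = nat_code b @ y \<Longrightarrow> a = b \<and> x = y"
proof (induction a arbitrary: b rule: nat_code.induct)
  case (1 a)
  show ?case
  proof (cases "a = 0 \<or> b = 0")
    case True
    then show ?thesis
      using "1.prems" by (auto simp: nat_code.simps[of a] nat_code.simps[of b] split: if_splits)
  next
    case False
    then have "odd a = odd b" "nat_code (a div 2) @ x = nat_code (b div 2) @ y"
      using "1.prems" by (auto simp: nat_code.simps[of a] nat_code.simps[of b])
    moreover from this have "a div 2 = b div 2" "x = y" using "1.IH" False by blast+
    ultimately show ?thesis by presburger
  qed
qed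

text \<open>The bound also holds for \<open>n = 0\<close>, since \<open>log 2 0 = 0\<close>.\<close>

lemma length_nat_code: "real (length (nat_code n)) \<le> 3 + 2 * log 2 (real n)"
proof (induction n rule: nat_code.induct)
  case (1 n)
  consider "n = 0" | "n = 1" | "n \<ge> 2" by linarith
  then show ?case
  proof cases
    case 3
    \<comment> \<open>Halving saves two bits and lowers the logarithm by at least 1, whence the
      factor 2. The constant 3 is the code length of 1.\<close>
    have "log 2 (real (n div 2)) \<le> log 2 (real n / 2)"
      using 3 by (subst log_le_cancel_iff) auto
    also have "\<dots> = log 2 (real n) - 1" using 3 by (simp add: log_divide)
    finally show ?thesis using 1 3 by (simp add: nat_code.simps[of n])
  next
    case 1
    then show ?thesis by (simp add: nat_code.simps[of 0] log_def)
  next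
    case 2
    then show ?thesis using nat_code.simps[of 0] nat_code.simps[of 1] by simp
  qed
qed

definition digit_lists :: "nat \<Rightarrow> nat list set" where
  "digit_lists h = {ds. set ds \<subseteq> {..<h}}"

text \<open>There are \<open>h ^ k\<close> such lists and at least as many bit strings of the given
  length. Encoding a list as a whole loses less than one bit to rounding, instead of up to one bit
  per number.\<close>

lemma block_code_exists:
  assumes "h > 0"
  shows "\<exists>g. inj_on g {ds \<in> digit_lists h. length ds = k} \<and>
    (\<forall>ds \<in> {ds \<in> digit_lists h. length ds = k}.
       length (g ds :: bool list) = nat \<lceil>real k * log 2 (real h)\<rceil>)"
proof -
  define B where "B = nat \<lceil>real k * log 2 (real h)\<rceil>"
  let ?X = "{ds \<in> digit_lists h. length ds = k}"
  let ?Y = "{bs :: bool list. set bs \<subseteq> UNIV \<and> length bs = B}"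
  have X: "?X = {ds. set ds \<subseteq> {..<h} \<and> length ds = k}" by (auto simp: digit_lists_def)
  have "real k * log 2 (real h) \<le> real B" unfolding B_def by linarith
  then have "log 2 (real h ^ k) \<le> real B" using assms by (simp add: log_nat_power)
  then have "real h ^ k \<le> 2 powr real B" using assms by (subst (asm) log_le_iff) auto
  then have "real (h ^ k) \<le> real (2 ^ B)" by (simp add: powr_realpow)
  then have "h ^ k \<le> 2 ^ B" by (simp only: of_nat_le_iff)
  moreover have "card ?X = h ^ k"
    unfolding X by (simp add: card_lists_length_eq)
  moreover have "card ?Y = 2 ^ B"
    by (subst card_lists_length_eq) simp_all
  ultimately have "card ?X \<le> card ?Y" by simp
  moreover have "finite ?X" "finite ?Y"
    unfolding X by (simp_all only: finite_lists_length_eq finite_lessThan finite)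
  ultimately obtain g where "g ` ?X \<subseteq> ?Y" "inj_on g ?X"
    using card_le_inj[of ?X ?Y] by blast
  then show ?thesis unfolding B_def by (intro exI[of _ g]) auto
qed

text \<open>With \<open>x\<close> and \<open>y\<close> empty, this includes injectivity of the
  code.\<close>

definition prefix_free_on :: "'a set \<Rightarrow> ('a \<Rightarrow> bool list) \<Rightarrow> bool" where
  "prefix_free_on C code \<longleftrightarrow>
     (\<forall>a\<in>C. \<forall>b\<in>C. \<forall>x y. code a @ x = code b @ y \<longrightarrow> a = b)"

text \<open>The self-delimiting length comes first and determines the size of the block that
  follows. The constant 4 is 3 from \<open>nat_code\<close> plus 1 for rounding up.\<close>

lemma digit_code_exists:
  assumes "h > 0"
  obtains code :: "nat list \<Rightarrow> bool list"
  where "prefix_free_on (digit_lists h) code"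
    and "\<And>ds. ds \<in> digit_lists h \<Longrightarrow> real (length (code ds)) \<le>
      real (length ds) * log 2 (real h) + (4 + 2 * log 2 (real (length ds)))"
proof -
  have "\<exists>g. \<forall>k. inj_on (g k) {ds \<in> digit_lists h. length ds = k} \<and>
    (\<forall>ds \<in> {ds \<in> digit_lists h. length ds = k}.
       length (g k ds :: bool list) = nat \<lceil>real k * log 2 (real h)\<rceil>)"
    using block_code_exists[OF assms] by (intro choice) blast
  then obtain g :: "nat \<Rightarrow> nat list \<Rightarrow> bool list" where
    inj: "\<And>k. inj_on (g k) {ds \<in> digit_lists h. length ds = k}" and
    len: "\<And>ds. ds \<in> digit_lists h \<Longrightarrow>
       length (g (length ds) ds) = nat \<lceil>real (length ds) * log 2 (real h)\<rceil>"
    by blast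
  define code where "code ds = nat_code (length ds) @ g (length ds) ds" for ds
  show ?thesis
  proof (rule that[of code], unfold prefix_free_on_def, intro ballI allI impI)
    fix ds es x y
    assume *: "ds \<in> digit_lists h" "es \<in> digit_lists h" "code ds @ x = code es @ y"
    then have l: "length ds = length es" and "g (length ds) ds @ x = g (length es) es @ y"
      using nat_code_prefix_free unfolding code_def append_assoc by blast+
    then have "g (length ds) ds = g (length ds) es"
      using len[OF *(1)] len[OF *(2)] by simp
    then show "ds = es" using inj[of "length ds"] * l by (auto dest: inj_onD)
  next
    fix ds assume "ds \<in> digit_lists h"
    moreover have "0 \<le> log 2 (real h)" using assms by simp
    then have "0 \<le> real (length ds) * log 2 (real h)" by simp
    then have "real (nat \<lceil>real (length ds) * log 2 (real h)\<rceil>) \<le> real (length ds) * log 2 (real h) + 1"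
      by linarith
    ultimately show "real (length (code ds)) \<le>
      real (length ds) * log 2 (real h) + (4 + 2 * log 2 (real (length ds)))"
      using len[of ds] length_nat_code[of "length ds"] by (simp add: code_def)
  qed
qed


section \<open>The algorithm\<close>

text \<open>Reading stops as soon as the bits form a code word. All advice is thus read in the first
  step, and each step replays the procedure from the start instead of keeping a state.\<close>

definition advised ::
  "(nat list \<Rightarrow> bool list) \<Rightarrow> 'h sgraph \<Rightarrow> 'v advice_algorithm" where
  "advised code H us K bs =
     (if bs \<in> code ` digit_lists (card (edges H))
      then Output (fst (resolve_steps H K us
        (inv_into (digit_lists (card (edges H))) code bs) (length us)))
      else Read_Bit)"

context
  fixes code :: "nat list \<Rightarrow> bool list" and H :: "'h sgraph" and ds :: "nat list" and \<phi> :: tape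
  assumes prefix_free: "prefix_free_on (digit_lists (card (edges H))) code"
    and ds: "ds \<in> digit_lists (card (edges H))"
    and \<phi>: "tape_prefix \<phi> (length (code ds)) = code ds"
begin

lemma advised_output:
  "advised code H us K (code ds) = Output (fst (resolve_steps H K us ds (length us)))"
proof -
  have "inj_on code (digit_lists (card (edges H)))"
    using prefix_free unfolding prefix_free_on_def by (metis inj_onI)
  then show ?thesis using ds by (simp add: advised_def)
qed

text \<open>A proper prefix of the code word of \<open>ds\<close> is no code word, so reading cannot
  stop early.\<close>

lemma advised_read:
  assumes "m < length (code ds)"
  shows "advised code H us K (tape_prefix \<phi> m) = Read_Bit"
proof -
  have "tape_prefix \<phi> m \<noteq> code es" if "es \<in> digit_lists (card (edges H))" for es
  proof
    assume es: "tape_prefix \<phi> m = code es"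
    have "code ds = tape_prefix \<phi> m @ drop m (code ds)"
      using assms by (metis \<phi> append_take_drop_id take_map take_upt add_0 less_imp_le tape_prefix_def)
    then have "code ds @ [] = code es @ drop m (code ds)" using es by simp
    then have "ds = es" using prefix_free ds that unfolding prefix_free_on_def by blast
    moreover have "length (code es) = m"
      using arg_cong[OF es, of length] by (simp add: tape_prefix_def)
    ultimately show False using assms by simp
  qed
  then show ?thesis by (auto simp: advised_def)
qed

text \<open>Covers both the first step, where \<open>m = 0\<close>, and the later ones, where the
  whole code word has been read and no bit is added.\<close>

lemma advised_step_run:
  assumes "m \<le> length (code ds)"
  shows "step_run (advised code H) us K \<phi> m
    (fst (resolve_steps H K us ds (length us))) (length (code ds))"
  using assms
proof (induction m rule: inc_induct)
  case base
  show ?case by (rule output_set) (simp add: \<phi> advised_output)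
next
  case (step n)
  show ?case by (rule read_bit[OF advised_read[OF step.hyps(2)] step.IH])
qed

text \<open>The number of bits is only bounded, since nothing is read before the first step.\<close>

lemma advised_partial_run:
  assumes "i \<le> length vs"
  shows "\<exists>m \<le> length (code ds). partial_run (advised code H) G vs \<phi>
    (map (\<lambda>j. fst (resolve_steps H G vs ds (Suc j))) [0..<i]) m"
  using assms
proof (induction i)
  case 0
  show ?case by (auto intro: run_start)
next
  case (Suc i)
  then obtain m where m: "m \<le> length (code ds)" "partial_run (advised code H) G vs \<phi>
    (map (\<lambda>j. fst (resolve_steps H G vs ds (Suc j))) [0..<i]) m" by auto
  have "step_run (advised code H) (take (Suc i) vs) (revealed G vs (Suc i)) \<phi> m
    (fst (resolve_steps H G vs ds (Suc i))) (length (code ds))"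
    using advised_step_run[OF m(1), of "take (Suc i) vs" "revealed G vs (Suc i)"] Suc.prems
    by (simp only: resolve_steps_revealed order_refl length_take min_absorb2)
  from run_step[OF m(2) _ _ this] show ?case using Suc.prems by auto
qed

end

theorem theorem2:
  fixes H :: "'h sgraph"
  assumes "simple_graph H" and "edges H \<noteq> {}"
  shows "\<exists>(A :: 'v advice_algorithm) (f :: nat \<Rightarrow> real).
           f \<in> O(\<lambda>k. log 2 (real k)) \<and>
           optimal_with_advice H A (\<lambda>k. real k * log 2 (real (card (edges H))) + f k)"
proof -
  define h where "h = card (edges H)"
  have fin: "finite (edges H)" using finite_edges assms(1) .
  have "h > 0" using fin assms(2) by (simp add: h_def card_gt_0_iff)
  then obtain code :: "nat list \<Rightarrow> bool list" where
    prefix_free: "prefix_free_on (digit_lists h) code" and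
    len: "\<And>ds. ds \<in> digit_lists h \<Longrightarrow> real (length (code ds)) \<le>
      real (length ds) * log 2 (real h) + (4 + 2 * log 2 (real (length ds)))"
    using digit_code_exists by blast
  define f where "f k = 4 + 2 * log 2 (real k)" for k
  have "f \<in> O(\<lambda>k. log 2 (real k))"
  \<comment> \<open>For \<open>k \<ge> 2\<close> the logarithm is at least 1, so 4 is at most 4
    times the logarithm.\<close>
  proof (rule bigoI[where c = 6])
    show "\<forall>\<^sub>F k in sequentially. norm (f k) \<le> 6 * norm (log 2 (real k))"
      using eventually_ge_at_top[of 2]
    proof eventually_elim
      case (elim k)
      then have "log 2 (real k) \<ge> 1" by (subst le_log_iff) auto
      then show ?case by (simp add: f_def)
    qed
  qed
  moreover have "optimal_with_advice H (advised code H :: 'v advice_algorithm)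
    (\<lambda>k. real k * log 2 (real (card (edges H))) + f k)"
    unfolding optimal_with_advice_def
  proof (intro allI impI)
    fix G :: "'v sgraph" and vs
    assume inst: "online_instance G vs"
    let ?n = "length vs"
    obtain T where T: "T \<subseteq> edges G" "free_of H (delete_edges G T)" "card T = opt H G"
      using opt_attained[OF assms] .
    have "finite T"
      using T(1) inst finite_edges finite_subset by (metis online_instance_def)
    obtain ds S where "set ds \<subseteq> {..<h}" and S: "S \<subseteq> T" "card S = length ds"
      and run: "\<And>rest. resolve_steps H G vs (ds @ rest) ?n = (S, rest)"
      and "\<And>j rest. j \<in> {1..?n} \<Longrightarrow> let Sj = fst (resolve_steps H G vs (ds @ rest) j) in
       Sj \<subseteq> edges (revealed G vs j) \<and> free_of H (delete_edges (revealed G vs j) Sj) \<and>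
       fst (resolve_steps H G vs (ds @ rest) (j - 1)) \<subseteq> Sj"
      using resolve_steps_into[OF inst fin T(1,2) order_refl] unfolding h_def by blast
    from this(1) this(5)[of _ "[]"] have ds: "ds \<in> digit_lists h"
      and good: "\<And>j. j \<in> {1..?n} \<Longrightarrow> fst (resolve_steps H G vs ds j) \<subseteq> edges (revealed G vs j) \<and>
        free_of H (delete_edges (revealed G vs j) (fst (resolve_steps H G vs ds j))) \<and>
        fst (resolve_steps H G vs ds (j - 1)) \<subseteq> fst (resolve_steps H G vs ds j)"
      by (simp_all add: digit_lists_def Let_def)
    define Ss where "Ss = map (\<lambda>j. fst (resolve_steps H G vs ds (Suc j))) [0..<?n]"
    have last: "last ({} # Ss) = S"
      using run[of "[]"] by (cases ?n) (auto simp: Ss_def)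
    \<comment> \<open>Feasibility gives \<open>opt H G \<le> card S\<close>, and
      \<open>S \<subseteq> T\<close> the converse; so exactly \<open>opt H G\<close> numbers are
      used. Without vertices there is no last step to appeal to.\<close>
    have "free_of H (delete_edges G S)"
    proof (cases "?n = 0")
      case True
      then have "verts G = {}" using inst by (simp add: online_instance_def)
      then have "edges (delete_edges G S) = {}"
        using inst by (fastforce simp: online_instance_def simple_graph_def delete_edges_def)
      then show ?thesis using free_of_edgeless[OF assms] by blast
    next
      case False
      have "revealed G vs ?n = G"
        using inst by (auto simp: revealed_def induced_def online_instance_def simple_graph_def
            intro!: sgraph.equality)
      then show ?thesis using good[of ?n] run[of "[]"] False by simp
    qed
    then have card: "card S = opt H G"
      using opt_le[of S G H] S(1) T card_mono[OF \<open>finite T\<close> S(1)] by auto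
    have "sorted_wrt (\<subseteq>) Ss"
      unfolding sorted_wrt_iff_nth_less
    proof (intro allI impI)
      fix i j assume "i < j" "j < length Ss"
      then show "Ss ! i \<subseteq> Ss ! j"
      proof (induction j)
        case (Suc j)
        \<comment> \<open>Index \<open>j\<close> of \<open>Ss\<close> belongs to step
          \<open>j + 1\<close>, hence the double successor.\<close>
        have step: "Ss ! j \<subseteq> Ss ! Suc j"
          using good[of "Suc (Suc j)"] Suc.prems
          by (simp add: Ss_def del: resolve_steps.simps)
        show ?case using Suc step by (cases "i = j") auto
      qed simp
    qed
    moreover have "Ss ! (i - 1) = fst (resolve_steps H G vs ds i)" if "i \<in> {1..?n}" for i
      using that by (cases i) (simp_all add: Ss_def del: resolve_steps.simps)
    ultimately have sol: "online_solution H G vs Ss"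
      using good unfolding online_solution_def by (simp add: Ss_def)
    \<comment> \<open>Beyond the code word the tape is unspecified; those bits are never
      read.\<close>
    define \<phi> where "\<phi> i = (code ds ! i)" for i
    have \<phi>: "tape_prefix \<phi> (length (code ds)) = code ds"
      by (rule nth_equalityI) (simp_all add: tape_prefix_def \<phi>_def)
    obtain m where m: "m \<le> length (code ds)" "partial_run (advised code H) G vs \<phi> Ss m"
      using advised_partial_run[OF prefix_free[unfolded h_def] ds[unfolded h_def] \<phi> order_refl]
      unfolding Ss_def by blast
    have "real m \<le> real (opt H G) * log 2 (real h) + f (opt H G)"
      using len[OF ds] m(1) S(2) card unfolding f_def by simp
    then show "\<exists>\<phi> Ss m. complete_run (advised code H) G vs \<phi> Ss m \<and> online_solution H G vs Ss \<and>
      cost Ss = opt H G \<and> real m \<le> real (opt H G) * log 2 (real (card (edges H))) + f (opt H G)"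
      using m sol card last unfolding complete_run_def cost_def h_def
      by (intro exI[of _ \<phi>] exI[of _ Ss] exI[of _ m]) (simp add: Ss_def)
  qed
  ultimately show ?thesis by blast
qed

end
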